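(* Let $n\geq 1$ and $0\le k<n$ be integers. Then $$\int_{0}^{\infty}\frac{\sinh((2k+1)x)}{x\cosh^{2n+1}x}\,dx=\sum_{p=1}^{n}(2^{2p+1}-1)\,\Bigl([z^{2n}]\,U_{2k}(z)(\arcsin z)^{2p}\Bigr)\frac{\zeta(2p+1)}{\pi^{2p}},$$ and $$\int_{0}^{\infty}\frac{\sinh((2k+1)x)}{x\cosh^{2n}x}\,dx=\sum_{p=1}^{n}2^{2p}\,\Bigl([z^{2n-1}]\,U_{2k}(z)(\arcsin z)^{2p-1}\Bigr)\frac{\beta(2p)}{\pi^{2p-1}}.$$
   Context: $U_m$ is the Chebyshev polynomial of the second kind, normalized by $U_m(\cos\theta)=\frac{\sin((m+1)\theta)}{\sin\theta}$. $\zeta$ is the Riemann zeta function and $\beta$ is the Dirichlet beta function, $\beta(s)=\sum_{r\ge0}(-1)^r(2r+1)^{-s}$. $[z^r]F(z)$ denotes the coefficient of $z^r$ in the expansion of $F$ at the origin; $\arcsin$ is the principal branch. *)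

theory Defs
  imports "HOL-Complex_Analysis.Complex_Analysis"
begin

definition chebyshev_U :: "nat \<Rightarrow> complex poly" where
  "chebyshev_U m = (THE p. \<forall>\<theta>. sin \<theta> \<noteq> 0 \<longrightarrow>
     poly p (cos \<theta>) = sin ((of_nat m + 1) * \<theta>) / sin \<theta>)"

(* The description above is well defined. *)

lemma chebyshev_U_exists:
  "\<exists>p :: complex poly. \<forall>\<theta>. poly p (cos \<theta>) * sin \<theta> = sin ((of_nat m + 1) * \<theta>)"
proof (induction m rule: induct_nat_012)
  case 0
  show ?case by (rule exI[of _ 1]) simp
next
  case 1
  have "poly [:0, 2:] (cos \<theta>) * sin \<theta> = sin ((of_nat (Suc 0) + 1) * \<theta>)" for \<theta> :: complex
    using sin_double[of \<theta>] by (simp add: algebra_simps)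
  then show ?case by blast
next
  case (ge2 m)
  then obtain p q :: "complex poly" where
    p: "\<And>\<theta>. poly p (cos \<theta>) * sin \<theta> = sin ((of_nat m + 1) * \<theta>)" and
    q: "\<And>\<theta>. poly q (cos \<theta>) * sin \<theta> = sin ((of_nat (Suc m) + 1) * \<theta>)"
    by blast
  have "poly ([:0, 2:] * q - p) (cos \<theta>) * sin \<theta> = sin ((of_nat (Suc (Suc m)) + 1) * \<theta>)"
    for \<theta> :: complex
  proof -
    define a where "a = (of_nat (Suc m) + 1) * \<theta>"
    have "poly ([:0, 2:] * q - p) (cos \<theta>) * sin \<theta>
        = 2 * cos \<theta> * (poly q (cos \<theta>) * sin \<theta>) - poly p (cos \<theta>) * sin \<theta>"
      by (simp add: algebra_simps)
    also have "\<dots> = 2 * cos \<theta> * sin a - sin (a - \<theta>)"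
      unfolding p q a_def by (simp add: algebra_simps)
    also have "\<dots> = sin (a + \<theta>)"
      by (simp add: sin_add sin_diff)
    also have "a + \<theta> = (of_nat (Suc (Suc m)) + 1) * \<theta>"
      by (simp add: a_def algebra_simps)
    finally show ?thesis .
  qed
  then show ?case by blast
qed

lemma poly_eq_if_eq_on_cos:
  fixes p q :: "complex poly"
  assumes "\<And>\<theta>. sin \<theta> \<noteq> 0 \<Longrightarrow> poly p (cos \<theta>) = poly q (cos \<theta>)"
  shows "p = q"
proof (rule ccontr)
  assume "p \<noteq> q"
  then have "finite {z. poly (p - q) z = 0}"
    by (intro poly_roots_finite) simp
  moreover have "UNIV - {1, -1} \<subseteq> {z. poly (p - q) z = 0}"
  proof
    fix z :: complex
    assume "z \<in> UNIV - {1, -1}"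
    then have "z\<^sup>2 \<noteq> 1" by (auto simp: power2_eq_1_iff)
    then have "sin (Arccos z) \<noteq> 0"
      using sin_cos_squared_add[of "Arccos z"] by auto
    from assms[OF this] show "z \<in> {z. poly (p - q) z = 0}" by simp
  qed
  ultimately have "finite (UNIV - {1, -1 :: complex})"
    using finite_subset by blast
  then show False
    using infinite_UNIV_char_0 by auto
qed

lemma chebyshev_U_cos:
  assumes "sin \<theta> \<noteq> 0"
  shows "poly (chebyshev_U m) (cos \<theta>) = sin ((of_nat m + 1) * \<theta>) / sin \<theta>"
proof -
  let ?P = "\<lambda>p :: complex poly. \<forall>\<theta>. sin \<theta> \<noteq> 0 \<longrightarrow>
     poly p (cos \<theta>) = sin ((of_nat m + 1) * \<theta>) / sin \<theta>"
  have "\<exists>!p. ?P p"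
  proof (rule ex_ex1I)
    obtain p :: "complex poly" where "\<And>\<theta>. poly p (cos \<theta>) * sin \<theta> = sin ((of_nat m + 1) * \<theta>)"
      using chebyshev_U_exists[of m] by blast
    then have "?P p" by (simp add: eq_divide_eq)
    then show "\<exists>p. ?P p" by blast
    show "p = q" if "?P p" "?P q" for p q
      using that by (intro poly_eq_if_eq_on_cos) simp
  qed
  from theI'[OF this] show ?thesis
    using assms unfolding chebyshev_U_def by blast
qed

(* The Dirichlet series represents the Riemann zeta function only on Re s > 1; outside that
   half-plane this constant carries no meaning (no analytic continuation is performed). *)
definition zeta :: "complex \<Rightarrow> complex" where
  "zeta s = (\<Sum>r. of_nat (Suc r) powr (- s))"

(* Meaningful for Re s > 0, where the series converges. *)
definition dirichlet_beta :: "complex \<Rightarrow> complex" where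
  "dirichlet_beta s = (\<Sum>r. (-1) ^ r * of_nat (2 * r + 1) powr (- s))"

(* Coefficient of z^r in the Taylor expansion of F at the origin, for F holomorphic near 0. *)
definition taylor_coeff :: "(complex \<Rightarrow> complex) \<Rightarrow> nat \<Rightarrow> complex" where
  "taylor_coeff F r = fps_nth (fps_expansion F 0) r"

end

theory Submission
  imports Defs
begin

text \<open>
  Since \<open>U\<^sub>2\<^sub>k(cosh x) = sinh ((2 k + 1) x) / sinh x\<close>, both integrands are linear combinations of
  \<open>D\<^sub>m(x) / x\<close> with \<open>D\<^sub>m(x) = sinh x / cosh\<^sup>m\<^sup>+\<^sup>1 x\<close>. The relation
  \<open>D\<^sub>m'' = m\<^sup>2 D\<^sub>m - (m + 1) (m + 2) D\<^sub>m\<^sub>+\<^sub>2\<close> is dual to the recurrence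
  \<open>(m + 1) (m + 2) A(q, m + 2) = m\<^sup>2 A(q, m) + q (q - 1) A(q - 2, m)\<close> for
  \<open>A(q, m) = [z\<^sup>m] arcsin\<^sup>q z\<close>, which comes from \<open>(1 - z\<^sup>2) y'' - z y' = q (q - 1) arcsin\<^sup>q\<^sup>-\<^sup>2 z\<close>
  for \<open>y = arcsin\<^sup>q z\<close>. Starting from the partial fractions of \<open>tanh\<close> and \<open>1 / cosh\<close>, this gives
  \<open>D\<^sub>m(x) = \<Sum>\<^sub>q A(q, m) \<Sum>\<^sub>j 2 (\<plusminus>1)\<^sup>j Im (c\<^sub>j - \<i> x)\<^sup>-\<^sup>q\<^sup>-\<^sup>1\<close> with \<open>c\<^sub>j = \<pi> (j + 1/2)\<close>.
  Each summand divided by \<open>x\<close> integrates to \<open>(\<plusminus>1)\<^sup>j \<pi> / c\<^sub>j\<^sup>q\<^sup>+\<^sup>1\<close>, and summing over \<open>j\<close> gives the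
  values of \<open>\<zeta>\<close> and \<open>\<beta>\<close>.
\<close>

section \<open>Powers of arcsin and Chebyshev polynomials\<close>

abbreviation arcsin_fps :: "complex fps" where
  "arcsin_fps \<equiv> fps_expansion Arcsin 0"

lemma Arcsin_has_fps_expansion: "Arcsin has_fps_expansion arcsin_fps"
proof -
  have "z \<in> ball 0 1 \<Longrightarrow> \<bar>Re z\<bar> < 1" for z :: complex
    using abs_Re_le_cmod[of z] by simp
  then have "Arcsin holomorphic_on ball 0 1"
    by (intro holomorphic_on_Arcsin) auto
  then show ?thesis
    by (intro has_fps_expansion_fps_expansion[of "ball 0 1"]) auto
qed

lemma arcsin_fps_0: "fps_nth arcsin_fps 0 = 0"
  by (simp add: fps_expansion_def)

text \<open>On the unit disc \<open>Arcsin\<close> has derivative 1 / cos(Arcsin z), and 1 - z^2 =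
  cos(Arcsin z)^2. Uniqueness of expansions carries this over to formal series. Squaring keeps the
  square root of 1 - z^2 out of the algebra.\<close>

lemma arcsin_fps_ode1: "(1 - fps_X\<^sup>2) * fps_deriv arcsin_fps ^ 2 = 1"
proof (rule fps_expansion_unique_complex)
  show "(\<lambda>z. (1 - z\<^sup>2) * deriv Arcsin z ^ 2) has_fps_expansion (1 - fps_X\<^sup>2) * fps_deriv arcsin_fps ^ 2"
    by (intro fps_expansion_intros Arcsin_has_fps_expansion)
  have "(1 - z\<^sup>2) * deriv Arcsin z ^ 2 = 1" if "z \<in> ball 0 1" for z :: complex
  proof -
    have *: "\<bar>Re z\<bar> < 1" using that abs_Re_le_cmod[of z] by simp
    have "deriv Arcsin z = inverse (cos (Arcsin z))"
      by (rule DERIV_imp_deriv[OF has_field_derivative_Arcsin]) (use * in auto)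
    moreover have "cos (Arcsin z) \<noteq> 0"
      using * by (intro cos_Arcsin_nonzero) (auto simp: power2_eq_1_iff)
    moreover have "1 - z\<^sup>2 = cos (Arcsin z) ^ 2"
      using sin_cos_squared_add[of "Arcsin z"] by (simp add: algebra_simps)
    ultimately have "(1 - z\<^sup>2) * deriv Arcsin z ^ 2 = (cos (Arcsin z) * inverse (cos (Arcsin z))) ^ 2"
      by (simp only: power_mult_distrib)
    then show ?thesis using \<open>cos (Arcsin z) \<noteq> 0\<close> by simp
  qed
  then have "\<forall>\<^sub>F z in nhds 0. (1 - z\<^sup>2) * deriv Arcsin z ^ 2 = (1::complex)"
    by (intro eventually_nhds_in_open[THEN eventually_mono, of "ball 0 1"]) auto
  then show "(\<lambda>z. (1 - z\<^sup>2) * deriv Arcsin z ^ 2) has_fps_expansion (1 :: complex fps)"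
    by (subst has_fps_expansion_cong) (auto intro: refl)
qed

text \<open>Differentiating \<open>arcsin_fps_ode1\<close> gives 2 g ((1 - X^2) g' - X g) = 0 for g
  = arcsin'. Formal series have no zero divisors and g is nonzero.\<close>

lemma arcsin_fps_ode2: "(1 - fps_X\<^sup>2) * fps_deriv (fps_deriv arcsin_fps) = fps_X * fps_deriv arcsin_fps"
proof -
  let ?g = "fps_deriv arcsin_fps"
  have "fps_deriv ((1 - fps_X\<^sup>2) * ?g ^ 2) = 0"
    unfolding arcsin_fps_ode1 by simp
  then have "2 * ?g * ((1 - fps_X\<^sup>2) * fps_deriv ?g - fps_X * ?g) = 0"
    by (simp add: fps_deriv_power power2_eq_square algebra_simps)
  moreover have "?g \<noteq> 0"
  proof
    assume "?g = 0"
    with arcsin_fps_ode1 show False by (metis mult_zero_right power_zero_numeral zero_neq_one)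
  qed
  ultimately show ?thesis by simp
qed

definition arcsin_power_coeff :: "nat \<Rightarrow> nat \<Rightarrow> complex" where
  "arcsin_power_coeff q m = fps_nth (arcsin_fps ^ q) m"

lemma arcsin_fps_power_ode:
  fixes q :: nat
  defines "y \<equiv> arcsin_fps ^ q"
  shows "(1 - fps_X\<^sup>2) * fps_deriv (fps_deriv y) - fps_X * fps_deriv y
      = of_nat (q * (q - 1)) * arcsin_fps ^ (q - 2)"
proof (cases "q < 2")
  case True
  \<comment> \<open>Here q (q - 1) = 0, so the truncated exponent \<open>q - 2\<close> does no harm;
    the case q = 1 is \<open>arcsin_fps_ode2\<close>.\<close>
  then have "q = 0 \<or> q = 1" by auto
  then show ?thesis
    using arcsin_fps_ode2 by (auto simp: y_def)
next
  case False
  then obtain r where q: "q = Suc (Suc r)"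
    by (metis add_2_eq_Suc le_Suc_ex not_less)
  let ?f = arcsin_fps and ?g = "fps_deriv arcsin_fps"
  have y': "fps_deriv y = of_nat q * (?f ^ Suc r * ?g)"
    unfolding y_def fps_deriv_power fps_of_nat by (simp add: q algebra_simps)
  have y'': "fps_deriv (fps_deriv y) =
      of_nat q * (of_nat (Suc r) * ?f ^ r * ?g ^ 2 + ?f ^ Suc r * fps_deriv ?g)"
    unfolding y' fps_deriv_mult fps_deriv_power fps_of_nat
    by (simp add: q algebra_simps power2_eq_square)
  have "(1 - fps_X\<^sup>2) * fps_deriv (fps_deriv y) - fps_X * fps_deriv y
     = of_nat (q * (q - 1)) * ?f ^ r * ((1 - fps_X\<^sup>2) * ?g ^ 2)
       + of_nat q * ?f ^ Suc r * ((1 - fps_X\<^sup>2) * fps_deriv ?g - fps_X * ?g)"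
    unfolding y'' unfolding y' of_nat_mult by (simp add: q algebra_simps power2_eq_square del: power_Suc of_nat_Suc)
  then show ?thesis
    by (simp add: arcsin_fps_ode1 arcsin_fps_ode2 q)
qed

text \<open>Coefficient of z^m in the differential equation: X^2 y'' contributes m (m - 1) and X y'
  contributes m, together m^2.\<close>

lemma arcsin_power_coeff_rec:
  "of_nat ((m + 1) * (m + 2)) * arcsin_power_coeff q (m + 2) =
     of_nat (m\<^sup>2) * arcsin_power_coeff q m + of_nat (q * (q - 1)) * arcsin_power_coeff (q - 2) m"
proof -
  define y where "y = arcsin_fps ^ q"
  have "fps_nth ((1 - fps_X\<^sup>2) * fps_deriv (fps_deriv y) - fps_X * fps_deriv y) m
     = of_nat (q * (q - 1)) * arcsin_power_coeff (q - 2) m"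
    unfolding y_def arcsin_fps_power_ode arcsin_power_coeff_def of_nat_mult
    by (simp flip: fps_of_nat add: mult.assoc)
  moreover have "fps_nth ((1 - fps_X\<^sup>2) * fps_deriv (fps_deriv y) - fps_X * fps_deriv y) m
     = of_nat ((m + 1) * (m + 2)) * arcsin_power_coeff q (m + 2) - of_nat (m\<^sup>2) * arcsin_power_coeff q m"
  proof -
    have X2: "fps_nth (fps_X\<^sup>2 * fps_deriv (fps_deriv y)) m = of_nat m * (of_nat m - 1) * fps_nth y m"
      by (cases m; cases "m - 1") (auto simp: fps_X_power_mult_nth numeral_2_eq_2 algebra_simps)
    have X1: "fps_nth (fps_X * fps_deriv y) m = of_nat m * fps_nth y m"
      by (cases m) auto
    show ?thesis
      unfolding left_diff_distrib fps_sub_nth X1 X2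
      by (simp add: arcsin_power_coeff_def y_def[symmetric] power2_eq_square algebra_simps)
  qed
  ultimately show ?thesis by (simp only: diff_eq_eq add.commute)
qed

lemma arcsin_power_coeff_0: "arcsin_power_coeff q 0 = (if q = 0 then 1 else 0)"
  by (simp add: arcsin_power_coeff_def fps_power_zeroth arcsin_fps_0)

lemma arcsin_power_coeff_0_left: "arcsin_power_coeff 0 m = (if m = 0 then 1 else 0)"
  by (simp add: arcsin_power_coeff_def)

lemma arcsin_power_coeff_1: "arcsin_power_coeff q (Suc 0) = (if q = 1 then 1 else 0)"
proof -
  have "deriv Arcsin 0 = 1"
    using DERIV_imp_deriv[OF has_field_derivative_Arcsin[of 0]] by simp
  then have "fps_nth arcsin_fps 1 = 1" by (simp add: fps_expansion_def)
  then show ?thesis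
    using arcsin_power_coeff_0 by (cases q) (auto simp: arcsin_power_coeff_def fps_mult_nth arcsin_fps_0)
qed

text \<open>The recurrence moves m by 2 and q by 0 or 2, so it preserves both the parity of m + q
  and the vanishing for m < q. For q < 2 the term in q - 2 carries the factor q (q - 1) = 0.\<close>

lemma arcsin_power_coeff_eq_0: "m < q \<or> odd (m + q) \<Longrightarrow> arcsin_power_coeff q m = 0"
proof (induction m arbitrary: q rule: induct_nat_012)
  case (ge2 m)
  have "of_nat (m\<^sup>2) * arcsin_power_coeff q m = 0"
    using ge2 by auto
  moreover have "of_nat (q * (q - 1)) * arcsin_power_coeff (q - 2) m = 0"
  proof (cases "q < 2")
    case False
    then have "m < q - 2 \<or> odd (m + (q - 2))" using ge2.prems by auto
    then have "arcsin_power_coeff (q - 2) m = 0" by (rule ge2.IH)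
    then show ?thesis by simp
  qed (auto simp: less_2_cases_iff)
  ultimately have "of_nat ((m + 1) * (m + 2)) * arcsin_power_coeff q (m + 2) = 0"
    by (simp only: arcsin_power_coeff_rec add_0)
  then have "arcsin_power_coeff q (m + 2) = 0"
    by (metis (no_types) add_is_0 mult_eq_0_iff of_nat_eq_0_iff zero_neq_numeral zero_neq_one)
  then show ?case by simp
qed (auto simp: arcsin_power_coeff_0 arcsin_power_coeff_1 elim: oddE)

lemma taylor_coeff_poly_Arcsin_power:
  "taylor_coeff (\<lambda>z. poly p z * Arcsin z ^ q) m = (\<Sum>i\<le>m. coeff p i * arcsin_power_coeff q (m - i))"
proof -
  have "poly p has_fps_expansion fps_of_poly p"
  proof (induction p)
    case (pCons a p)
    have "(\<lambda>z. a + z * poly p z) has_fps_expansion fps_const a + fps_X * fps_of_poly p"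
      by (intro fps_expansion_intros pCons.IH)
    then show ?case by (simp add: fps_of_poly_pCons mult.commute)
  qed simp
  then have "(\<lambda>z. poly p z * Arcsin z ^ q) has_fps_expansion fps_of_poly p * arcsin_fps ^ q"
    by (intro fps_expansion_intros Arcsin_has_fps_expansion)
  then have "fps_expansion (\<lambda>z. poly p z * Arcsin z ^ q) 0 = fps_of_poly p * arcsin_fps ^ q"
    by (rule fps_expansion_eqI)
  then show ?thesis
    by (simp add: taylor_coeff_def fps_mult_nth arcsin_power_coeff_def atLeast0AtMost)
qed

section \<open>Chebyshev polynomials: recurrence, parity, values at cosh x\<close>

lemma chebyshev_U_eqI:
  assumes "\<And>\<theta>. poly p (cos \<theta>) * sin \<theta> = sin ((of_nat m + 1) * \<theta>)"
  shows "chebyshev_U m = p"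
  by (rule poly_eq_if_eq_on_cos) (simp add: chebyshev_U_cos flip: assms)

text \<open>From sin(a + t) + sin(a - t) = 2 cos t sin a with a = (m + 2) t.\<close>

lemma chebyshev_U_rec:
  "chebyshev_U (Suc (Suc m)) = [:0, 2:] * chebyshev_U (Suc m) - chebyshev_U m"
proof (rule poly_eq_if_eq_on_cos)
  fix \<theta> :: complex assume s: "sin \<theta> \<noteq> 0"
  define a where "a = (of_nat (Suc m) + 1) * \<theta>"
  have "sin (a + \<theta>) / sin \<theta> = (2 * cos \<theta> * sin a - sin (a - \<theta>)) / sin \<theta>"
    by (simp add: sin_add sin_diff)
  then show "poly (chebyshev_U (Suc (Suc m))) (cos \<theta>) =
      poly ([:0, 2:] * chebyshev_U (Suc m) - chebyshev_U m) (cos \<theta>)"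
    by (simp add: chebyshev_U_cos[OF s] a_def algebra_simps flip: diff_divide_distrib add_divide_distrib)
qed

lemma coeff_chebyshev_U_eq_0: "m < i \<or> odd (m + i) \<Longrightarrow> coeff (chebyshev_U m) i = 0"
proof (induction m arbitrary: i rule: induct_nat_012)
  case 0
  have "chebyshev_U 0 = 1" by (rule chebyshev_U_eqI) simp
  with 0 show ?case by (auto simp: coeff_1 elim: oddE)
next
  case 1
  have "chebyshev_U (Suc 0) = [:0, 2:]"
    by (rule chebyshev_U_eqI) (simp add: sin_double[symmetric] mult_ac, metis sin_double mult.assoc mult.commute)
  with 1 show ?case by (auto simp: coeff_pCons split: nat.splits)
next
  case (ge2 m)
  then show ?case
    by (cases i) (auto simp: chebyshev_U_rec)
qed

lemma
  fixes y :: real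
  shows sin_i_times_real: "sin (\<i> * of_real y) = \<i> * of_real (sinh y)"
    and cos_i_times_real: "cos (\<i> * of_real y) = of_real (cosh y)"
  by (simp_all add: sin_exp_eq sinh_def cos_exp_eq cosh_def exp_of_real scaleR_conv_of_real
      field_simps flip: of_real_minus)

text \<open>The defining identity at the imaginary angle i x, where the factors i of the two sines
  cancel.\<close>

lemma chebyshev_U_cosh:
  assumes "x \<noteq> 0"
  shows "poly (chebyshev_U m) (of_real (cosh x)) = of_real (sinh (real (m + 1) * x) / sinh x)"
proof -
  have "sin (\<i> * of_real x) \<noteq> 0" unfolding sin_i_times_real using assms by simp
  from chebyshev_U_cos[OF this, of m]
  have "poly (chebyshev_U m) (of_real (cosh x)) = sin (\<i> * of_real (real (m + 1) * x)) / sin (\<i> * of_real x)"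
    unfolding cos_i_times_real by (simp add: algebra_simps)
  then show ?thesis unfolding sin_i_times_real by simp
qed

section \<open>Partial fractions\<close>

text \<open>For \<open>q > 0\<close> this is the sum of \<open>1 / (z + j)^(q + 1)\<close> over \<open>j \<ge> 0\<close>; for \<open>q = 0\<close> that series
  diverges and \<open>- Digamma z\<close> is its regularization.\<close>

definition hurwitz_sum :: "nat \<Rightarrow> complex \<Rightarrow> complex" where
  "hurwitz_sum q z = (-1) ^ Suc q / fact q * Polygamma q z"

text \<open>In the alternating case the even and odd j are summed separately: z + 2 k = 2 (z / 2 +
  k) and z + 2 k + 1 = 2 ((z + 1) / 2 + k), whence the factor 2^(q + 1).\<close>

definition lerch_sum :: "bool \<Rightarrow> nat \<Rightarrow> complex \<Rightarrow> complex" where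
  "lerch_sum alt q z =
     (if alt then (hurwitz_sum q (z / 2) - hurwitz_sum q ((z + 1) / 2)) / 2 ^ Suc q
      else hurwitz_sum q z)"

text \<open>With \<open>s = 1\<close> and \<open>alt = odd q\<close> this is the sum of \<open>(\<plusminus>1)^j / (z + j)^(q + 1)\<close> over all integers
  \<open>j\<close>: the negative \<open>j\<close> are reflected by \<open>z \<mapsto> 1 - z\<close>.\<close>

definition bilateral_sum :: "bool \<Rightarrow> complex \<Rightarrow> nat \<Rightarrow> complex \<Rightarrow> complex" where
  "bilateral_sum alt s q z = lerch_sum alt q z - s * lerch_sum alt q (1 - z)"

text \<open>At z = 1/2 - i x / pi this is i pi \<open>D\<^sub>m(x)\<close> in the notation of the
  overview.\<close>

definition cos_over_sin_power :: "nat \<Rightarrow> complex \<Rightarrow> complex" where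
  "cos_over_sin_power m z = of_real pi * cos (of_real pi * z) / sin (of_real pi * z) ^ Suc m"

lemma Re_pos_not_nonpos_Int: "Re z > 0 \<Longrightarrow> z \<notin> \<int>\<^sub>\<le>\<^sub>0"
  by (auto elim!: nonpos_Ints_cases)

lemma has_field_derivative_hurwitz_sum:
  assumes "Re z > 0"
  shows "(hurwitz_sum q has_field_derivative - of_nat (Suc q) * hurwitz_sum (Suc q) z) (at z)"
  unfolding hurwitz_sum_def [abs_def]
  by (rule derivative_eq_intros Re_pos_not_nonpos_Int assms refl)+ (simp del: of_nat_Suc)

lemma hurwitz_sum_sums:
  assumes "Re z > 0" "q > 0"
  shows "(\<lambda>j. 1 / (z + of_nat j) ^ Suc q) sums hurwitz_sum q z"
proof -
  have "z \<noteq> 0" using assms(1) by auto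
  then have "summable (\<lambda>j. inverse ((z + of_nat j) ^ Suc q))"
    using assms(2) by (intro Polygamma_converges') auto
  moreover have "(-1) ^ Suc q * (-1) ^ Suc q = (1 :: complex)"
    by (simp flip: power_add mult_2)
  then have "hurwitz_sum q z = (\<Sum>j. inverse ((z + of_nat j) ^ Suc q))"
    using assms(2) unfolding hurwitz_sum_def Polygamma_def by (simp add: mult_ac)
  ultimately show ?thesis
    by (simp add: summable_sums divide_inverse del: power_Suc)
qed

lemma has_field_derivative_lerch_sum:
  assumes "Re z > 0"
  shows "(lerch_sum alt q has_field_derivative - of_nat (Suc q) * lerch_sum alt (Suc q) z) (at z)"
proof (cases alt)
  case True
  have *: "((\<lambda>z. (hurwitz_sum q (z / 2) - hurwitz_sum q ((z + 1) / 2)) / 2 ^ Suc q) has_field_derivative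
      - of_nat (Suc q) * ((hurwitz_sum (Suc q) (z / 2) - hurwitz_sum (Suc q) ((z + 1) / 2)) / 2 ^ Suc (Suc q))) (at z)"
    by (rule derivative_eq_intros DERIV_chain2[OF has_field_derivative_hurwitz_sum] refl |
        use assms in simp; fail)+ (simp add: field_simps)
  show ?thesis using * True by (simp add: lerch_sum_def [abs_def])
next
  case False
  then show ?thesis
    using has_field_derivative_hurwitz_sum[OF assms] by (simp add: lerch_sum_def [abs_def])
qed

text \<open>Each half is padded with zeros to a series over all indices, and the two padded series
  are added termwise.\<close>

lemma sums_even_odd:
  fixes f :: "nat \<Rightarrow> 'a :: real_normed_vector"
  assumes "(\<lambda>j. f (2 * j)) sums a" "(\<lambda>j. f (2 * j + 1)) sums b"
  shows "f sums (a + b)"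
proof -
  have "(\<lambda>n. if even n then f n else 0) sums a"
    using assms(1) sums_mono_reindex[of "\<lambda>j. 2 * j" "\<lambda>n. if even n then f n else 0"]
    by (force simp: strict_mono_def elim: evenE)
  moreover have "(\<lambda>n. if odd n then f n else 0) sums b"
    using assms(2) sums_mono_reindex[of "\<lambda>j. 2 * j + 1" "\<lambda>n. if odd n then f n else 0"]
    by (force simp: strict_mono_def elim: oddE)
  ultimately have "(\<lambda>n. (if even n then f n else 0) + (if odd n then f n else 0)) sums (a + b)"
    by (rule sums_add)
  then show ?thesis by (rule sums_cong[THEN iffD1, rotated]) simp
qed

lemma lerch_sum_sums:
  assumes "Re z > 0" "q > 0"
  shows "(\<lambda>j. (if alt then (-1) ^ j else 1) / (z + of_nat j) ^ Suc q) sums lerch_sum alt q z"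
proof (cases alt)
  case True
  have args: "z / 2 + of_nat k = (z + of_nat (2 * k)) / 2"
    "(z + 1) / 2 + of_nat k = (z + of_nat (2 * k + 1)) / 2" for k
    by (simp_all add: field_simps)
  have "(\<lambda>j. 1 / (z / 2 + of_nat j) ^ Suc q / 2 ^ Suc q) sums (hurwitz_sum q (z / 2) / 2 ^ Suc q)"
    by (intro sums_divide hurwitz_sum_sums) (use assms in auto)
  moreover have "(\<lambda>j. - (1 / ((z + 1) / 2 + of_nat j) ^ Suc q / 2 ^ Suc q)) sums
      (- (hurwitz_sum q ((z + 1) / 2) / 2 ^ Suc q))"
    by (intro sums_minus sums_divide hurwitz_sum_sums) (use assms in auto)
  ultimately have "(\<lambda>j. (-1) ^ j / (z + of_nat j) ^ Suc q) sums
     (hurwitz_sum q (z / 2) / 2 ^ Suc q + - (hurwitz_sum q ((z + 1) / 2) / 2 ^ Suc q))"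
    unfolding args by (intro sums_even_odd) (simp_all add: power_divide del: power_Suc of_nat_add of_nat_mult of_nat_Suc)
  then show ?thesis using True by (simp add: lerch_sum_def diff_divide_distrib)
next
  case False
  then show ?thesis using hurwitz_sum_sums[OF assms] by (simp add: lerch_sum_def)
qed

text \<open>The inner derivative of 1 - z flips the sign of s, so two derivatives restore
  it.\<close>

lemma has_field_derivative_bilateral_sum:
  assumes "0 < Re z" "Re z < 1"
  shows "(bilateral_sum alt s q has_field_derivative
           - of_nat (Suc q) * bilateral_sum alt (- s) (Suc q) z) (at z)"
  unfolding bilateral_sum_def [abs_def]
  by (rule derivative_eq_intros has_field_derivative_lerch_sum
       DERIV_chain2[OF has_field_derivative_lerch_sum] refl |
        use assms in simp; fail)+ (simp add: field_simps)

section \<open>Derivatives of the trigonometric side on the strip 0 < Re z < 1\<close>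

lemma sin_pi_neq_0:
  assumes "0 < Re z" "Re z < 1"
  shows "sin (of_real pi * z) \<noteq> 0"
proof
  assume "sin (of_real pi * z) = 0"
  then obtain k :: int where "of_real pi * z = of_int k * of_real pi"
    by (auto simp: sin_eq_0)
  then have "z = of_int k" by simp
  with assms show False by simp
qed

lemma has_field_derivative_inverse_sin_power:
  assumes "0 < Re z" "Re z < 1"
  shows "((\<lambda>z. 1 / sin (of_real pi * z) ^ m) has_field_derivative
           - of_nat m * cos_over_sin_power m z) (at z)"
  unfolding cos_over_sin_power_def
  by (rule derivative_eq_intros refl sin_pi_neq_0 assms power_not_zero)+
     (use sin_pi_neq_0[OF assms] in \<open>cases m; simp add: field_simps\<close>)

text \<open>Replacing cos^2 by 1 - sin^2 leaves only inverse powers of sin. Each of these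
  differentiates back into a \<open>cos_over_sin_power\<close>, so the second derivative stays
  within the family.\<close>

lemma has_field_derivative_cos_over_sin_power:
  assumes "0 < Re z" "Re z < 1"
  shows "(cos_over_sin_power m has_field_derivative
           of_real pi ^ 2 * (of_nat m * (1 / sin (of_real pi * z) ^ m) - of_nat (m + 1) * (1 / sin (of_real pi * z) ^ (m + 2)))) (at z)"
proof -
  let ?s = "sin (of_real pi * z)" and ?c = "cos (of_real pi * z)"
  have s: "?s \<noteq> 0" by (rule sin_pi_neq_0[OF assms])
  have c: "?c\<^sup>2 = 1 - ?s\<^sup>2" using sin_cos_squared_add[of "of_real pi * z"] by (simp add: algebra_simps)
  have "(cos_over_sin_power m has_field_derivative
      (of_real pi * (- ?s * of_real pi) * ?s ^ Suc m - of_real pi * ?c * (of_nat (Suc m) * ?s ^ m * (?c * of_real pi)))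
       / (?s ^ Suc m * ?s ^ Suc m)) (at z)"
    unfolding cos_over_sin_power_def [abs_def]
    by (rule derivative_eq_intros refl power_not_zero s)+ simp
  also have "of_real pi * (- ?s * of_real pi) * ?s ^ Suc m - of_real pi * ?c * (of_nat (Suc m) * ?s ^ m * (?c * of_real pi))
     = - (of_real pi ^ 2) * ?s ^ m * (?s ^ 2 + of_nat (Suc m) * ?c ^ 2)"
    by (simp add: algebra_simps power2_eq_square)
  also have "- (of_real pi ^ 2) * ?s ^ m * (?s ^ 2 + of_nat (Suc m) * ?c ^ 2) / (?s ^ Suc m * ?s ^ Suc m)
     = of_real pi ^ 2 * (of_nat m * (1 / ?s ^ m) - of_nat (m + 1) * (1 / ?s ^ (m + 2)))"
    unfolding c using s by (simp add: field_simps power2_eq_square)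
  finally show ?thesis .
qed

lemma has_field_derivative_cos_over_sin_power2:
  assumes "0 < Re z" "Re z < 1"
  shows "((\<lambda>z. of_real pi ^ 2 * (of_nat m * (1 / sin (of_real pi * z) ^ m) - of_nat (m + 1) * (1 / sin (of_real pi * z) ^ (m + 2))))
     has_field_derivative of_real pi ^ 2 *
       (of_nat ((m + 1) * (m + 2)) * cos_over_sin_power (m + 2) z - of_nat (m ^ 2) * cos_over_sin_power m z)) (at z)"
  by (rule derivative_eq_intros refl has_field_derivative_inverse_sin_power assms)+
     (simp add: algebra_simps power2_eq_square)

lemma open_strip: "open {z. 0 < Re z \<and> Re z < 1}"
  by (intro open_Collect_conj open_halfspace_Re_gt open_halfspace_Re_lt)

text \<open>The strip is open, so an identity known only there may be differentiated.\<close>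

lemma derivative_unique_on_strip:
  assumes eq: "\<And>z. 0 < Re z \<Longrightarrow> Re z < 1 \<Longrightarrow> f z = g z"
    and "(f has_field_derivative f') (at z)" "(g has_field_derivative g') (at z)"
    and z: "0 < Re z" "Re z < 1"
  shows "f' = g'"
proof -
  have "(f has_field_derivative g') (at z)"
    by (rule has_field_derivative_transform_within_open[OF assms(3) open_strip]) (use z eq in auto)
  with assms(2) show ?thesis by (rule DERIV_unique)
qed

text \<open>Differentiating the reflection formula \<open>rGamma z * rGamma (1 - z)\<close> = sin(pi
  z) / pi and dividing by it gives pi cot(pi z) = \<open>Digamma (1 - z) - Digamma z\<close>. Thus
  the regularized sums for q = 0 already have the right difference.\<close>

lemma cot_partial_fractions:
  assumes "0 < Re z" "Re z < 1"
  shows "cos_over_sin_power 0 z = bilateral_sum False 1 0 z"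
proof -
  have *: "z \<notin> \<int>\<^sub>\<le>\<^sub>0" "1 - z \<notin> \<int>\<^sub>\<le>\<^sub>0"
    using assms by (auto intro!: Re_pos_not_nonpos_Int)
  have r: "rGamma z \<noteq> 0" "rGamma (1 - z) \<noteq> 0"
    using * by (simp_all add: rGamma_eq_zero_iff)
  have "((\<lambda>z. rGamma z * rGamma (1 - z)) has_field_derivative
     (- rGamma z * Digamma z) * rGamma (1 - z) + (rGamma (1 - z) * Digamma (1 - z)) * rGamma z) (at z)"
    by (rule derivative_eq_intros refl * DERIV_chain2[OF has_field_derivative_rGamma_no_nonpos_int])+ simp
  moreover have "((\<lambda>z. sin (of_real pi * z) / of_real pi) has_field_derivative cos (of_real pi * z)) (at z)"
    by (rule derivative_eq_intros refl)+ auto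
  ultimately have "(- rGamma z * Digamma z) * rGamma (1 - z) + (rGamma (1 - z) * Digamma (1 - z)) * rGamma z
      = cos (of_real pi * z)"
    unfolding rGamma_reflection_complex by (rule DERIV_unique)
  then have "cos (of_real pi * z) = (rGamma z * rGamma (1 - z)) * (Digamma (1 - z) - Digamma z)"
    by (simp add: algebra_simps)
  then show ?thesis
    using sin_pi_neq_0[OF assms] unfolding rGamma_reflection_complex
    by (simp add: cos_over_sin_power_def bilateral_sum_def lerch_sum_def hurwitz_sum_def field_simps)
qed

text \<open>From \<open>1 / sin (2 w) = (cot w + tan w) / 2\<close>.\<close>

lemma csc_partial_fractions:
  assumes "0 < Re z" "Re z < 1"
  shows "of_real pi / sin (of_real pi * z) = bilateral_sum True (-1) 0 z"
proof -
  define w where "w = of_real pi * z / 2"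
  have s: "sin (2 * w) \<noteq> 0" using sin_pi_neq_0[OF assms] by (simp add: w_def)
  then have nz: "sin w \<noteq> 0" "cos w \<noteq> 0" by (auto simp: sin_double)
  have w1: "of_real pi * (z / 2) = w" "of_real pi * ((1 - z) / 2) = of_real pi / 2 - w"
    by (simp_all add: w_def field_simps)
  have "cos_over_sin_power 0 (z / 2) + cos_over_sin_power 0 ((1 - z) / 2)
      = of_real pi * (cos w / sin w + sin w / cos w)"
    unfolding cos_over_sin_power_def w1 by (simp add: sin_diff cos_diff sin_of_real cos_of_real algebra_simps)
  also have "cos w / sin w + sin w / cos w = 1 / (sin w * cos w)"
    using nz sin_cos_squared_add[of w] by (simp add: field_simps power2_eq_square)
  finally have "cos_over_sin_power 0 (z / 2) + cos_over_sin_power 0 ((1 - z) / 2) = 2 * of_real pi / sin (2 * w)"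
    by (simp add: sin_double)
  moreover have "cos_over_sin_power 0 (z / 2) + cos_over_sin_power 0 ((1 - z) / 2) = 2 * bilateral_sum True (-1) 0 z"
  proof -
    \<comment> \<open>The reflected arguments of the two cotangents are the shifted halves in
      \<open>lerch_sum True\<close>; regrouping the four Hurwitz sums gives an alternating sum at z
      plus one at 1 - z.\<close>
    have "1 - z / 2 = (1 - z + 1) / 2" "1 - (1 - z) / 2 = (z + 1) / 2"
      by (simp_all add: field_simps)
    note args = this
    have "cos_over_sin_power 0 (z / 2) = bilateral_sum False 1 0 (z / 2)"
       "cos_over_sin_power 0 ((1 - z) / 2) = bilateral_sum False 1 0 ((1 - z) / 2)"
      by (rule cot_partial_fractions; use assms in simp)+
    then show ?thesis unfolding bilateral_sum_def lerch_sum_def args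
      by (simp add: diff_divide_distrib)
  qed
  ultimately have "2 * (of_real pi / sin (of_real pi * z)) = 2 * bilateral_sum True (-1) 0 z"
    by (simp add: w_def)
  then show ?thesis by (subst (asm) mult_left_cancel) simp_all
qed

text \<open>Derivative of the cosecant expansion, which turns s = -1 into s = 1. It is the second
  base case of the induction in steps of two.\<close>

lemma cos_over_sin_power_1:
  assumes "0 < Re z" "Re z < 1"
  shows "of_real pi * cos_over_sin_power 1 z = bilateral_sum True 1 1 z"
proof -
  have d: "((\<lambda>z. of_real pi / sin (of_real pi * z)) has_field_derivative - (of_real pi * cos_over_sin_power 1 z)) (at z)"
    using DERIV_cmult[OF has_field_derivative_inverse_sin_power[OF assms, of 1], of "of_real pi"] by simp
  have "- (of_real pi * cos_over_sin_power 1 z) = - of_nat (Suc 0) * bilateral_sum True (- (-1)) (Suc 0) z"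
    by (rule derivative_unique_on_strip[OF csc_partial_fractions d has_field_derivative_bilateral_sum])
       (use assms in auto)
  then show ?thesis by simp
qed

text \<open>The sequences \<open>cos / sin^(m + 1)\<close> and \<open>arcsin^q\<close> obey dual second-order recurrences, so
  differentiating the identity for \<open>m\<close> twice gives the one for \<open>m + 2\<close>.\<close>

lemma cos_over_sin_power_expansion:
  assumes "0 < Re z" "Re z < 1"
  shows "cos_over_sin_power m z =
    (\<Sum>q\<le>m. arcsin_power_coeff q m / of_real pi ^ q * bilateral_sum (odd q) 1 q z)"
  using assms
proof (induction m arbitrary: z rule: induct_nat_012)
  case 0
  then show ?case by (simp add: arcsin_power_coeff_0 cot_partial_fractions)
next
  case 1
  then show ?case using cos_over_sin_power_1[OF 1] by (simp add: arcsin_power_coeff_1 field_simps)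
next
  case (ge2 m)
  define H where "H q = bilateral_sum (odd q) 1 q" for q
  define H1 where "H1 q z = - of_nat (Suc q) * bilateral_sum (odd q) (- 1) (Suc q) z" for q z
  have H1: "(H q has_field_derivative H1 q z) (at z)" if "0 < Re z" "Re z < 1" for q z
    unfolding H_def H1_def by (rule has_field_derivative_bilateral_sum[OF that])
  \<comment> \<open>Two derivatives yield (-(q + 1)) (-(q + 2)), restore s = 1, and keep the parity
    flag because q and q + 2 have the same parity.\<close>
  have H2: "(H1 q has_field_derivative of_nat ((q + 1) * (q + 2)) * H (q + 2) z) (at z)"
    if "0 < Re z" "Re z < 1" for q z
    unfolding H_def H1_def
    by (rule derivative_eq_intros has_field_derivative_bilateral_sum[OF that] refl)+ (simp add: algebra_simps)
  let ?a = "\<lambda>q. arcsin_power_coeff q m / of_real pi ^ q"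
  have eq0: "cos_over_sin_power m z = (\<Sum>q\<le>m. ?a q * H q z)" if "0 < Re z" "Re z < 1" for z
    unfolding H_def using ge2.IH(1) that by blast
  have d1: "((\<lambda>z. \<Sum>q\<le>m. ?a q * H q z) has_field_derivative (\<Sum>q\<le>m. ?a q * H1 q z)) (at z)"
    if "0 < Re z" "Re z < 1" for z
    by (intro DERIV_sum DERIV_cmult H1 that)
  have d2: "((\<lambda>z. \<Sum>q\<le>m. ?a q * H1 q z) has_field_derivative
       (\<Sum>q\<le>m. ?a q * (of_nat ((q + 1) * (q + 2)) * H (q + 2) z))) (at z)"
    if "0 < Re z" "Re z < 1" for z
    by (intro DERIV_sum DERIV_cmult H2 that)
  note eq1 = derivative_unique_on_strip[OF eq0 has_field_derivative_cos_over_sin_power d1]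
  have eq2: "of_real pi ^ 2 *
       (of_nat ((m + 1) * (m + 2)) * cos_over_sin_power (m + 2) z - of_nat (m ^ 2) * cos_over_sin_power m z)
     = (\<Sum>q\<le>m. ?a q * (of_nat ((q + 1) * (q + 2)) * H (q + 2) z))"
    by (rule derivative_unique_on_strip[OF eq1 has_field_derivative_cos_over_sin_power2 d2])
       (use ge2.prems in auto)
  let ?g = "\<lambda>q. of_nat (q * (q - 1)) * arcsin_power_coeff (q - 2) m / of_real pi ^ q * H q z"
  have "of_nat ((m + 1) * (m + 2)) * cos_over_sin_power (m + 2) z
     = of_nat (m ^ 2) * cos_over_sin_power m z
       + (\<Sum>q\<le>m. ?a q * (of_nat ((q + 1) * (q + 2)) * H (q + 2) z)) / of_real pi ^ 2"
    unfolding eq2[symmetric] by simp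
  also have "(\<Sum>q\<le>m. ?a q * (of_nat ((q + 1) * (q + 2)) * H (q + 2) z)) / of_real pi ^ 2
     = (\<Sum>q\<le>m. ?g (Suc (Suc q)))"
    unfolding sum_divide_distrib by (intro sum.cong refl) (simp add: field_simps power2_eq_square)
  \<comment> \<open>The terms q = 0 and q = 1 that the shift adds vanish through the factor q (q -
    1).\<close>
  also have "\<dots> = (\<Sum>q\<le>m + 2. ?g q)"
    by (simp add: sum.atMost_Suc_shift mult.commute del: sum.atMost_Suc of_nat_Suc of_nat_mult of_nat_add)
  \<comment> \<open>The range can grow to m + 2 because A(q, m) = 0 for q > m; the two sums then
    merge by the arcsine recurrence.\<close>
  also have "of_nat (m ^ 2) * cos_over_sin_power m z = (\<Sum>q\<le>m + 2. of_nat (m ^ 2) * arcsin_power_coeff q m / of_real pi ^ q * H q z)"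
    by (simp add: eq0[OF ge2.prems] sum_distrib_left arcsin_power_coeff_eq_0 mult_ac)
  also have "\<dots> + (\<Sum>q\<le>m + 2. ?g q) =
     (\<Sum>q\<le>m + 2. (of_nat (m ^ 2) * arcsin_power_coeff q m + of_nat (q * (q - 1)) * arcsin_power_coeff (q - 2) m) / of_real pi ^ q * H q z)"
    by (simp add: sum.distrib[symmetric] add_divide_distrib distrib_right del: sum.atMost_Suc)
  also have "\<dots> = of_nat ((m + 1) * (m + 2)) * (\<Sum>q\<le>m + 2. arcsin_power_coeff q (m + 2) / of_real pi ^ q * H q z)"
    unfolding arcsin_power_coeff_rec[symmetric] sum_distrib_left by (intro sum.cong refl) simp
  finally have "cos_over_sin_power (m + 2) z = (\<Sum>q\<le>m + 2. arcsin_power_coeff q (m + 2) / of_real pi ^ q * H q z)"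
    by (subst (asm) mult_left_cancel) (simp_all only: of_nat_eq_0_iff, simp)
  then show ?case by (simp add: H_def)
qed

section \<open>Integrals of the partial fractions\<close>

context
  fixes c :: real
  assumes c: "c > 0"
begin

text \<open>The antiderivative arctan(x / c) / c rises from 0 to pi / (2 c); nonnegativity of the
  integrand yields integrability along with the value.\<close>

lemma integral_inverse_sum_squares:
  "set_integrable lborel {0<..} (\<lambda>x. 1 / (x\<^sup>2 + c\<^sup>2))"
  "(LINT x:{0<..}|lborel. 1 / (x\<^sup>2 + c\<^sup>2)) = pi / (2 * c)"
proof -
  have nz: "x\<^sup>2 + c\<^sup>2 \<noteq> 0" for x :: real
    using c by (simp add: sum_power2_eq_zero_iff)
  have d: "((\<lambda>x. arctan (x / c) / c) has_real_derivative 1 / (x\<^sup>2 + c\<^sup>2)) (at x)" for x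
  proof -
    have "1 + (x / c)\<^sup>2 = (x\<^sup>2 + c\<^sup>2) / c\<^sup>2"
      using c by (simp add: field_simps)
    then have "inverse (1 + (x / c)\<^sup>2) * (1 / c) / c = 1 / (x\<^sup>2 + c\<^sup>2)"
      using c by (simp add: power2_eq_square)
    moreover have "((\<lambda>x. arctan (x / c) / c) has_real_derivative inverse (1 + (x / c)\<^sup>2) * (1 / c) / c) (at x)"
      by (rule derivative_eq_intros refl | use c in simp; fail)+
    ultimately show ?thesis by simp
  qed
  have c0: "isCont (\<lambda>x. 1 / (x\<^sup>2 + c\<^sup>2)) x" for x
    using nz by (intro continuous_intros) auto
  have l0: "(((\<lambda>x. arctan (x / c) / c) \<circ> real_of_ereal) \<longlongrightarrow> 0) (at_right (ereal 0))"
    unfolding ereal_tendsto_simps by (rule tendsto_eq_intros refl | use c in simp; fail)+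
  have "LIM x at_top. x / c :> at_top"
    using c by (intro filterlim_at_top_mult_tendsto_pos[OF tendsto_const, of "1 / c", simplified]) 
               (auto intro: filterlim_ident)
  then have "((\<lambda>x. arctan (x / c) / c) \<longlongrightarrow> pi / 2 / c) at_top"
    using c by (intro tendsto_intros filterlim_compose[OF tendsto_arctan_at_top]) auto
  then have l1: "(((\<lambda>x. arctan (x / c) / c) \<circ> real_of_ereal) \<longlongrightarrow> pi / 2 / c) (at_left \<infinity>)"
    unfolding ereal_tendsto_simps .
  note FTC = interval_integral_FTC_nonneg[of "ereal 0" \<infinity>, OF _ d c0 _ l0 l1]
  show "set_integrable lborel {0<..} (\<lambda>x. 1 / (x\<^sup>2 + c\<^sup>2))"
    using FTC(1) by (simp add: einterval_def greaterThan_def)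
  show "(LINT x:{0<..}|lborel. 1 / (x\<^sup>2 + c\<^sup>2)) = pi / (2 * c)"
    using FTC(2) by (simp add: interval_lebesgue_integral_def einterval_def greaterThan_def)
qed

text \<open>With z = 1/2 - i x / pi and c = pi (j + 1/2) one has pi (z + j) = c - i x, so this is
  the partial fraction at one pole, rescaled by pi.\<close>

abbreviation inv_lin :: "real \<Rightarrow> complex" where
  "inv_lin x \<equiv> inverse (of_real c - \<i> * of_real x)"

lemma denom_nonzero: "of_real c - \<i> * of_real x \<noteq> 0"
  using c by (simp add: complex_eq_iff)

lemma norm_inv_lin: "norm (inv_lin x) ^ 2 = 1 / (x\<^sup>2 + c\<^sup>2)"
proof -
  have "norm (of_real c - \<i> * of_real x) ^ 2 = x\<^sup>2 + c\<^sup>2"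
    by (simp add: cmod_power2)
  then show ?thesis unfolding norm_inverse power_inverse by (simp add: inverse_eq_divide)
qed

text \<open>Imaginary part of c w^(q + 1) = w^q + i x w^(q + 1), where w = 1 / (c - i x). Division
  by x then lowers the power at the cost of a real part.\<close>

lemma Im_inv_lin_power_Suc:
  "c * Im (inv_lin x ^ Suc q) = Im (inv_lin x ^ q) + x * Re (inv_lin x ^ Suc q)"
proof -
  have "of_real c * inv_lin x ^ Suc q = ((of_real c - \<i> * of_real x) * inv_lin x) * inv_lin x ^ q + \<i> * of_real x * inv_lin x ^ Suc q"
    by (simp add: algebra_simps)
  then have "of_real c * inv_lin x ^ Suc q = inv_lin x ^ q + \<i> * of_real x * inv_lin x ^ Suc q"
    using denom_nonzero by simp
  from arg_cong[OF this, of Im] show ?thesis by (simp del: power_Suc)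
qed

text \<open>Two of the factors give exactly 1 / (x^2 + c^2); each of the other q is at most 1 /
  c.\<close>

lemma norm_inv_lin_power: "norm (inv_lin x ^ Suc (Suc q)) \<le> 1 / c ^ q * (1 / (x\<^sup>2 + c\<^sup>2))"
proof -
  have "c \<le> norm (of_real c - \<i> * of_real x)"
    using complex_Re_le_cmod[of "of_real c - \<i> * of_real x"] by simp
  then have "norm (inv_lin x) \<le> 1 / c"
    using c unfolding norm_inverse by (simp only: le_imp_inverse_le flip: inverse_eq_divide)
  then have "norm (inv_lin x) ^ q \<le> (1 / c) ^ q"
    by (intro power_mono) auto
  then have "norm (inv_lin x) ^ q * norm (inv_lin x) ^ 2 \<le> (1 / c) ^ q * norm (inv_lin x) ^ 2"
    by (intro mult_right_mono) auto
  also have "norm (inv_lin x) ^ q * norm (inv_lin x) ^ 2 = norm (inv_lin x ^ Suc (Suc q))"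
    unfolding norm_power by (simp add: power2_eq_square mult_ac)
  finally show ?thesis
    unfolding norm_inv_lin by (simp only: power_one_over)
qed

lemma continuous_inv_lin: "continuous_on UNIV inv_lin"
  using denom_nonzero by (intro continuous_intros) auto

text \<open>Since w' = i w^2 for w = 1 / (c - i x), the function Im(w^(q + 1)) / (q + 1) is an
  antiderivative. It vanishes at 0, where w is real, and at infinity, where w tends to 0.\<close>

lemma integral_Re_inv_lin_power:
  "set_integrable lborel {0<..} (\<lambda>x. Re (inv_lin x ^ Suc (Suc q)))"
  "(LINT x:{0<..}|lborel. Re (inv_lin x ^ Suc (Suc q))) = 0"
proof -
  let ?f = "\<lambda>x. Re (inv_lin x ^ Suc (Suc q))" and ?F = "\<lambda>x. Im (inv_lin x ^ Suc q) / real (Suc q)"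
  have cont: "continuous_on UNIV ?f"
    by (intro continuous_intros continuous_inv_lin)
  show int: "set_integrable lborel {0<..} ?f"
  proof (rule set_integrable_bound)
    show "set_integrable lborel {0<..} (\<lambda>x. 1 / c ^ q * (1 / (x\<^sup>2 + c\<^sup>2)))"
      by (intro set_integrable_mult_right integral_inverse_sum_squares)
    show "set_borel_measurable lborel {0<..} ?f"
      unfolding set_borel_measurable_def
      using borel_measurable_continuous_onI[OF cont] by (simp del: power_Suc)
    show "AE x in lborel. x \<in> {0<..} \<longrightarrow> norm (?f x) \<le> norm (1 / c ^ q * (1 / (x\<^sup>2 + c\<^sup>2)))"
    proof (intro AE_I2 impI)
      fix x :: real
      have "norm (?f x) \<le> norm (inv_lin x ^ Suc (Suc q))"
        using abs_Re_le_cmod[of "inv_lin x ^ Suc (Suc q)"] by simp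
      also note norm_inv_lin_power
      finally show "norm (?f x) \<le> norm (1 / c ^ q * (1 / (x\<^sup>2 + c\<^sup>2)))"
        using c by simp
    qed
  qed
  have d: "(?F has_vector_derivative ?f x) (at x)" for x
  proof -
    have "((\<lambda>z. inverse (of_real c - \<i> * z) ^ Suc q) has_field_derivative
        of_nat (Suc q) * \<i> * inv_lin x ^ Suc (Suc q)) (at (of_real x))"
      by (rule derivative_eq_intros refl denom_nonzero)+
         (simp add: denom_nonzero power2_eq_square field_simps)
    then have "((\<lambda>x. inv_lin x ^ Suc q) has_vector_derivative
        of_nat (Suc q) * \<i> * inv_lin x ^ Suc (Suc q)) (at x)"
      by (rule has_vector_derivative_real_field)
    then have "((\<lambda>x. Im (inv_lin x ^ Suc q)) has_vector_derivative
        Im (of_nat (Suc q) * \<i> * inv_lin x ^ Suc (Suc q))) (at x)"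
      by (rule bounded_linear.has_vector_derivative[OF bounded_linear_Im])
    then have "(?F has_vector_derivative
        Im (of_nat (Suc q) * \<i> * inv_lin x ^ Suc (Suc q)) / real (Suc q)) (at x)"
      by (rule has_vector_derivative_divide)
    then show ?thesis by (simp add: mult.assoc del: power_Suc of_nat_Suc)
  qed
  have "isCont ?F 0"
    using d has_vector_derivative_continuous by blast
  then have "(?F \<longlongrightarrow> 0) (at_right 0)"
    unfolding isCont_def by (rule tendsto_mono[rotated, THEN tendsto_eq_rhs])
      (auto simp: at_le simp flip: of_real_inverse of_real_power simp del: power_Suc)
  then have l0: "((?F \<circ> real_of_ereal) \<longlongrightarrow> 0) (at_right (ereal 0))"
    unfolding ereal_tendsto_simps .
  have "(inv_lin \<longlongrightarrow> 0) at_top"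
  proof (rule tendsto_norm_zero_cancel, rule tendsto_sandwich[of "\<lambda>_. 0" _ _ "\<lambda>x. 1 / x"])
    show "\<forall>\<^sub>F x in at_top. norm (inv_lin x) \<le> 1 / x"
      using eventually_gt_at_top[of 0]
    proof eventually_elim
      case (elim x)
      have "x \<le> norm (of_real c - \<i> * of_real x)"
        using abs_Im_le_cmod[of "of_real c - \<i> * of_real x"] by simp
      with elim show ?case
        unfolding norm_inverse by (simp only: le_imp_inverse_le flip: inverse_eq_divide)
    qed
    show "((\<lambda>x::real. 1 / x) \<longlongrightarrow> 0) at_top"
      by (intro tendsto_divide_0[OF tendsto_const] filterlim_at_top_imp_at_infinity filterlim_ident)
  qed auto
  then have "(?F \<longlongrightarrow> Im (0 ^ Suc q) / real (Suc q)) at_top"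
    by (intro tendsto_intros) auto
  then have l1: "((?F \<circ> real_of_ereal) \<longlongrightarrow> 0) (at_left \<infinity>)"
    unfolding ereal_tendsto_simps by simp
  have "(LBINT x=ereal 0..\<infinity>. ?f x) = 0 - 0"
  proof (rule interval_integral_FTC_integrable[OF _ d _ _ l0 l1])
    show "isCont ?f x" for x using cont by (simp add: continuous_on_eq_continuous_at)
    show "set_integrable lborel (einterval (ereal 0) \<infinity>) ?f"
      using int by (simp add: einterval_def greaterThan_def)
  qed auto
  then show "(LINT x:{0<..}|lborel. ?f x) = 0"
    by (simp add: interval_lebesgue_integral_def einterval_def greaterThan_def)
qed

lemma Im_inv_lin_power_over_x_rec:
  assumes "x > 0"
  shows "Im (inv_lin x ^ Suc (Suc q)) / x = (1 / c) * (Im (inv_lin x ^ Suc q) / x + Re (inv_lin x ^ Suc (Suc q)))"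
  using Im_inv_lin_power_Suc[of x "Suc q"] c assms by (simp add: field_simps del: power_Suc)

lemma Im_inv_lin_over_x:
  assumes "x > 0"
  shows "Im (inv_lin x) / x = 1 / (x\<^sup>2 + c\<^sup>2)"
  using assms by (simp add: add.commute)

text \<open>The value does not change along the recursion up to the factor \<open>1 / c\<close>, because the
  correction terms \<open>Re (inv_lin x ^ (q + 2))\<close> integrate to zero.\<close>

lemma integral_Im_inv_lin_power:
  "set_integrable lborel {0<..} (\<lambda>x. Im (inv_lin x ^ Suc q) / x) \<and>
   (LINT x:{0<..}|lborel. Im (inv_lin x ^ Suc q) / x) = pi / (2 * c ^ Suc q)"
proof (induction q)
  case 0
  have "set_integrable lborel {0<..} (\<lambda>x. Im (inv_lin x) / x) = set_integrable lborel {0<..} (\<lambda>x. 1 / (x\<^sup>2 + c\<^sup>2))"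
    by (rule set_integrable_cong) (auto simp: Im_inv_lin_over_x)
  moreover have "(LINT x:{0<..}|lborel. Im (inv_lin x) / x) = (LINT x:{0<..}|lborel. 1 / (x\<^sup>2 + c\<^sup>2))"
    by (rule set_lebesgue_integral_cong) (auto simp: Im_inv_lin_over_x)
  ultimately show ?case using integral_inverse_sum_squares by simp
next
  case (Suc q)
  let ?g = "\<lambda>x. (1 / c) * (Im (inv_lin x ^ Suc q) / x + Re (inv_lin x ^ Suc (Suc q)))"
  have "set_integrable lborel {0<..} ?g"
    using Suc.IH integral_Re_inv_lin_power by (intro set_integrable_mult_right set_integral_add) auto
  moreover have "(LINT x:{0<..}|lborel. ?g x) = pi / (2 * c ^ Suc (Suc q))"
    using Suc.IH integral_Re_inv_lin_power[of q] by (simp add: set_integral_add del: power_Suc) simp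
  moreover have "set_integrable lborel {0<..} (\<lambda>x. Im (inv_lin x ^ Suc (Suc q)) / x) = set_integrable lborel {0<..} ?g"
    by (rule set_integrable_cong) (auto simp: Im_inv_lin_power_over_x_rec simp del: power_Suc)
  moreover have "(LINT x:{0<..}|lborel. Im (inv_lin x ^ Suc (Suc q)) / x) = (LINT x:{0<..}|lborel. ?g x)"
    by (rule set_lebesgue_integral_cong) (auto simp: Im_inv_lin_power_over_x_rec simp del: power_Suc)
  ultimately show ?case by simp
qed

text \<open>Each step of the recursion adds one more copy of the bound for the real part, hence the
  factor q + 1. This majorant serves the termwise integration over all poles.\<close>

lemma Im_inv_lin_power_bound:
  assumes "x > 0"
  shows "\<bar>Im (inv_lin x ^ Suc q) / x\<bar> \<le> real (Suc q) / c ^ q * (1 / (x\<^sup>2 + c\<^sup>2))"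
proof (induction q)
  case 0
  then show ?case using Im_inv_lin_over_x[OF assms] by simp
next
  case (Suc q)
  let ?r = "1 / (x\<^sup>2 + c\<^sup>2)"
  have "\<bar>Re (inv_lin x ^ Suc (Suc q))\<bar> \<le> 1 / c ^ q * ?r"
    using abs_Re_le_cmod norm_inv_lin_power order_trans by blast
  with Suc.IH have "\<bar>Im (inv_lin x ^ Suc q) / x + Re (inv_lin x ^ Suc (Suc q))\<bar>
      \<le> real (Suc q) / c ^ q * ?r + 1 / c ^ q * ?r"
    by linarith
  also have "\<dots> = real (Suc (Suc q)) / c ^ q * ?r"
    by (simp add: add_divide_distrib algebra_simps)
  finally have "(1 / c) * \<bar>Im (inv_lin x ^ Suc q) / x + Re (inv_lin x ^ Suc (Suc q))\<bar>
      \<le> (1 / c) * (real (Suc (Suc q)) / c ^ q * ?r)"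
    using c by (intro mult_left_mono) auto
  then show ?case
    unfolding Im_inv_lin_power_over_x_rec[OF assms] abs_mult using c by (simp add: mult.assoc)
qed

end

section \<open>Series over the poles \<open>c\<^sub>j\<close> and their termwise integration\<close>

abbreviation pole :: "nat \<Rightarrow> real" where
  "pole j \<equiv> pi * (real j + 1 / 2)"

abbreviation alt_sign :: "nat \<Rightarrow> nat \<Rightarrow> real" where
  "alt_sign q j \<equiv> if odd q then (-1) ^ j else 1"

definition pole_series :: "nat \<Rightarrow> real \<Rightarrow> real" where
  "pole_series q x = (\<Sum>j. 2 * alt_sign q j * Im (inv_lin (pole j) x ^ Suc q))"

definition pole_sum :: "nat \<Rightarrow> real" where
  "pole_sum q = (\<Sum>j. alt_sign q j * pi / pole j ^ Suc q)"

text \<open>On the line Re z = 1/2 the reflection 1 - z is the conjugate of z, so the terms of the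
  bilateral sum pair up as w - cnj w = 2 i Im w.\<close>

lemma pole_series_sums:
  fixes x :: real
  assumes "q > 0"
  defines "z \<equiv> 1 / 2 - \<i> * of_real (x / pi)"
  shows "(\<lambda>j. 2 * alt_sign q j * Im (inv_lin (pole j) x ^ Suc q)) sums pole_series q x"
    and "of_real (pole_series q x) = - \<i> / of_real pi ^ Suc q * bilateral_sum (odd q) 1 q z"
proof -
  have z: "Re z = 1 / 2" "1 - z = cnj z" by (simp_all add: z_def complex_eq_iff)
  have "(\<lambda>j. - \<i> / of_real pi ^ Suc q *
      ((if odd q then (-1) ^ j else 1) / (z + of_nat j) ^ Suc q -
       (if odd q then (-1) ^ j else 1) / (1 - z + of_nat j) ^ Suc q)) sums
      (- \<i> / of_real pi ^ Suc q * bilateral_sum (odd q) 1 q z)"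
    unfolding bilateral_sum_def mult_1
    by (intro sums_mult sums_diff lerch_sum_sums) (use z assms in auto)
  also have "(\<lambda>j. - \<i> / of_real pi ^ Suc q *
      ((if odd q then (-1) ^ j else 1) / (z + of_nat j) ^ Suc q -
       (if odd q then (-1) ^ j else 1) / (1 - z + of_nat j) ^ Suc q))
     = (\<lambda>j. of_real (2 * alt_sign q j * Im (inv_lin (pole j) x ^ Suc q)))"
  proof
    fix j
    let ?w = "inv_lin (pole j) x ^ Suc q"
    have inv: "1 / (a / b) ^ n = b ^ n * inverse a ^ n" for a b :: complex and n
      unfolding power_inverse power_divide by (simp add: field_simps)
    have z_eq: "z + of_nat j = (of_real (pole j) - \<i> * of_real x) / of_real pi"
      by (simp add: z_def field_simps)
    have 1: "1 / (z + of_nat j) ^ Suc q = of_real pi ^ Suc q * ?w"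
      unfolding z_eq by (rule inv)
    have "1 / (1 - z + of_nat j) ^ Suc q = cnj (1 / (z + of_nat j) ^ Suc q)"
      by (simp add: z)
    also have "\<dots> = of_real pi ^ Suc q * cnj ?w"
      unfolding 1 by simp
    finally have 2: "1 / (1 - z + of_nat j) ^ Suc q = of_real pi ^ Suc q * cnj ?w" .
    have term_eq: "- \<i> / of_real pi ^ Suc q * (s / (z + of_nat j) ^ Suc q - s / (1 - z + of_nat j) ^ Suc q)
      = s * (- \<i> * (?w - cnj ?w))" for s
    proof -
      have "- \<i> / of_real pi ^ Suc q * (s / (z + of_nat j) ^ Suc q - s / (1 - z + of_nat j) ^ Suc q)
        = - \<i> / of_real pi ^ Suc q * (s * (1 / (z + of_nat j) ^ Suc q) - s * (1 / (1 - z + of_nat j) ^ Suc q))"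
        by simp
      also have "\<dots> = (of_real pi ^ Suc q / of_real pi ^ Suc q) * (s * (- \<i> * (?w - cnj ?w)))"
        unfolding 1 2 by (simp add: algebra_simps del: power_Suc divide_self_if)
      finally show ?thesis by simp
    qed
    have cnj_eq: "- \<i> * (w - cnj w) = of_real (2 * Im w)" for w
      by (simp add: complex_eq_iff)
    show "- \<i> / of_real pi ^ Suc q *
      ((if odd q then (-1) ^ j else 1) / (z + of_nat j) ^ Suc q -
       (if odd q then (-1) ^ j else 1) / (1 - z + of_nat j) ^ Suc q)
       = of_real (2 * alt_sign q j * Im ?w)"
      unfolding term_eq cnj_eq by (cases "odd q") (simp_all del: power_Suc)
  qed
  finally have s: "(\<lambda>j. of_real (2 * alt_sign q j * Im (inv_lin (pole j) x ^ Suc q))) sums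
     (- \<i> / of_real pi ^ Suc q * bilateral_sum (odd q) 1 q z)" .
  then have "summable (\<lambda>j. 2 * alt_sign q j * Im (inv_lin (pole j) x ^ Suc q))"
    unfolding summable_def sums_complex_iff by auto
  then show 1: "(\<lambda>j. 2 * alt_sign q j * Im (inv_lin (pole j) x ^ Suc q)) sums pole_series q x"
    unfolding pole_series_def by (rule summable_sums)
  show "of_real (pole_series q x) = - \<i> / of_real pi ^ Suc q * bilateral_sum (odd q) 1 q z"
    by (rule sums_unique2[OF sums_of_real[OF 1] s])
qed

text \<open>The bound N lets expansions for different m share one range of q.\<close>

lemma sinh_over_cosh_power_expansion:
  assumes "0 < m" "m \<le> N"
  shows "of_real (sinh x / cosh x ^ Suc m) = (\<Sum>q = 1..N. arcsin_power_coeff q m * of_real (pole_series q x))"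
proof -
  define z where "z = 1 / 2 - \<i> * of_real (x / pi)"
  have z: "Re z = 1 / 2" by (simp add: z_def)
  have pz: "of_real pi * z = of_real pi / 2 - \<i> * of_real x"
    by (simp add: z_def algebra_simps)
  have s: "sin (of_real pi * z) = of_real (cosh x)" "cos (of_real pi * z) = \<i> * of_real (sinh x)"
    unfolding pz
    by (simp_all add: sin_diff cos_diff sin_of_real cos_of_real sin_i_times_real cos_i_times_real)
  have "of_real (sinh x / cosh x ^ Suc m) = - \<i> / of_real pi * cos_over_sin_power m z"
    unfolding cos_over_sin_power_def s by (simp add: field_simps)
  also have "\<dots> = (\<Sum>q\<le>m. - \<i> / of_real pi * (arcsin_power_coeff q m / of_real pi ^ q * bilateral_sum (odd q) 1 q z))"
    unfolding sum_distrib_left[symmetric]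
    by (subst cos_over_sin_power_expansion) (use z in auto)
  \<comment> \<open>The regularized term q = 0 drops out because A(0, m) = 0 for m > 0.\<close>
  also have "\<dots> = (\<Sum>q = 1..m. arcsin_power_coeff q m * (- \<i> / of_real pi ^ Suc q * bilateral_sum (odd q) 1 q z))"
    by (rule sum.mono_neutral_cong_right)
       (use assms in \<open>auto simp: Suc_le_eq not_less_eq_eq arcsin_power_coeff_0_left\<close>)
  also have "\<dots> = (\<Sum>q = 1..m. arcsin_power_coeff q m * of_real (pole_series q x))"
    by (intro sum.cong refl) (simp add: pole_series_sums(2) z_def)
  also have "\<dots> = (\<Sum>q = 1..N. arcsin_power_coeff q m * of_real (pole_series q x))"
    by (rule sum.mono_neutral_left) (use assms in \<open>auto simp: arcsin_power_coeff_eq_0\<close>)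
  finally show ?thesis .
qed

lemma summable_inverse_pole_power:
  assumes "q \<ge> 2"
  shows "summable (\<lambda>j. 1 / pole j ^ q)"
proof -
  have "summable (\<lambda>j. inverse ((1 / 2 + real j) ^ q))"
    using assms by (intro Polygamma_converges') auto
  then have "summable (\<lambda>j. 1 / pi ^ q * inverse ((1 / 2 + real j) ^ q))"
    by (rule summable_mult)
  then show ?thesis
    by (simp add: power_mult_distrib inverse_eq_divide add.commute)
qed

text \<open>Sum and integral are interchanged because the terms are absolutely summable at each x
  and their L1 norms are summable over the poles.\<close>

lemma integral_pole_series:
  assumes "q > 0"
  shows "set_integrable lborel {0<..} (\<lambda>x. pole_series q x / x)"
    and "(LINT x:{0<..}|lborel. pole_series q x / x) = pole_sum q"
proof -
  define f where "f j x = indicator {0<..} x *\<^sub>R (2 * alt_sign q j * (Im (inv_lin (pole j) x ^ Suc q) / x))" for j x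
  have p: "pole j > 0" for j by simp
  note I = integral_Im_inv_lin_power[OF p, of _ q]
  have int: "integrable lborel (f j)" for j
    using set_integrable_mult_right[of "2 * alt_sign q j", OF I[THEN conjunct1]]
    unfolding f_def set_integrable_def by blast
  have val: "integral\<^sup>L lborel (f j) = alt_sign q j * pi / pole j ^ Suc q" for j
  proof -
    have "integral\<^sup>L lborel (f j) = (LINT x:{0<..}|lborel. 2 * alt_sign q j * (Im (inv_lin (pole j) x ^ Suc q) / x))"
      unfolding f_def set_lebesgue_integral_def ..
    also have "\<dots> = 2 * alt_sign q j * (pi / (2 * pole j ^ Suc q))"
      unfolding set_integral_mult_right I[THEN conjunct2] ..
    finally show ?thesis by (simp del: power_Suc)
  qed
  have bound: "norm (f j x) \<le> indicator {0<..} x * (2 * (real (Suc q) / pole j ^ q * (1 / (x\<^sup>2 + (pole j)\<^sup>2))))" for j x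
    using Im_inv_lin_power_bound[OF p, of x j q]
    by (auto simp: f_def indicator_def abs_mult simp del: power_Suc of_nat_Suc)
  have sum1: "summable (\<lambda>j. norm (f j x))" for x
  proof (rule summable_comparison_test)
    show "summable (\<lambda>j. 2 * real (Suc q) * (1 / pole j ^ (q + 2)))"
      by (intro summable_mult summable_inverse_pole_power) simp
    show "\<exists>N. \<forall>j\<ge>N. norm (norm (f j x)) \<le> 2 * real (Suc q) * (1 / pole j ^ (q + 2))"
    proof (intro exI allI impI)
      fix j
      have "1 / (x\<^sup>2 + (pole j)\<^sup>2) \<le> 1 / (pole j)\<^sup>2"
        using p[of j] by (intro divide_left_mono) (auto intro!: mult_pos_pos add_nonneg_pos)
      then have "real (Suc q) / pole j ^ q * (1 / (x\<^sup>2 + (pole j)\<^sup>2)) \<le> real (Suc q) / pole j ^ q * (1 / (pole j)\<^sup>2)"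
        by (intro mult_left_mono) auto
      also have "\<dots> = real (Suc q) * (1 / pole j ^ (q + 2))"
        by (simp only: power_add times_divide_times_eq times_divide_eq_right mult_1_right divide_divide_eq_left)
      finally have "indicator {0<..} x * (2 * (real (Suc q) / pole j ^ q * (1 / (x\<^sup>2 + (pole j)\<^sup>2))))
          \<le> 2 * (real (Suc q) * (1 / pole j ^ (q + 2)))"
        by (auto simp: indicator_def simp del: of_nat_Suc)
      with bound[of j x] show "norm (norm (f j x)) \<le> 2 * real (Suc q) * (1 / pole j ^ (q + 2))"
        by (simp only: real_norm_def abs_norm_cancel mult.assoc)
    qed
  qed
  \<comment> \<open>The majorant integrates to (q + 1) pi / \<open>c\<^sub>j\<close>^(q + 1), which
    is summable since q >= 1.\<close>
  have sum2: "summable (\<lambda>j. \<integral>x. norm (f j x) \<partial>lborel)"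
  proof (rule summable_comparison_test)
    show "summable (\<lambda>j. real (Suc q) * pi * (1 / pole j ^ Suc q))"
      using assms by (intro summable_mult summable_inverse_pole_power) simp
    show "\<exists>N. \<forall>j\<ge>N. norm (\<integral>x. norm (f j x) \<partial>lborel) \<le> real (Suc q) * pi * (1 / pole j ^ Suc q)"
    proof (intro exI allI impI)
      fix j
      note J = integral_inverse_sum_squares[OF p[of j]]
      have val_bound: "2 * (a / r ^ q * (pi / (2 * r))) = a * pi * (1 / r ^ Suc q)" for a r :: real
        by simp
      have "(\<integral>x. norm (f j x) \<partial>lborel)
        \<le> (LINT x:{0<..}|lborel. 2 * (real (Suc q) / pole j ^ q * (1 / (x\<^sup>2 + (pole j)\<^sup>2))))"
        unfolding set_lebesgue_integral_def
      proof (rule integral_mono)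
        show "integrable lborel (\<lambda>x. indicator {0<..} x *\<^sub>R (2 * (real (Suc q) / pole j ^ q * (1 / (x\<^sup>2 + (pole j)\<^sup>2)))))"
          unfolding set_integrable_def[symmetric] by (intro set_integrable_mult_right J)
        show "integrable lborel (\<lambda>x. norm (f j x))"
          by (rule integrable_norm[OF int])
        show "norm (f j x) \<le> indicator {0<..} x *\<^sub>R (2 * (real (Suc q) / pole j ^ q * (1 / (x\<^sup>2 + (pole j)\<^sup>2))))" for x
          using bound unfolding real_scaleR_def .
      qed
      also have "\<dots> = real (Suc q) * pi * (1 / pole j ^ Suc q)"
        unfolding set_integral_mult_right J(2) by (rule val_bound)
      finally have "(\<integral>x. norm (f j x) \<partial>lborel) \<le> real (Suc q) * pi * (1 / pole j ^ Suc q)" .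
      moreover have "0 \<le> (\<integral>x. norm (f j x) \<partial>lborel)"
        by (rule integral_nonneg_AE) (rule AE_I2, rule norm_ge_zero)
      ultimately show "norm (\<integral>x. norm (f j x) \<partial>lborel) \<le> real (Suc q) * pi * (1 / pole j ^ Suc q)"
        unfolding real_norm_def by (rule abs_of_nonneg[THEN ord_eq_le_trans, rotated])
    qed
  qed
  have eq: "(\<Sum>j. f j x) = indicator {0<..} x *\<^sub>R (pole_series q x / x)" for x
  proof -
    have s: "(\<lambda>j. indicator {0<..} x * (2 * alt_sign q j * Im (inv_lin (pole j) x ^ Suc q) / x)) sums
       (indicator {0<..} x * (pole_series q x / x))"
      by (intro sums_mult sums_divide pole_series_sums assms)
    have "(\<lambda>j. f j x) = (\<lambda>j. indicator {0<..} x * (2 * alt_sign q j * Im (inv_lin (pole j) x ^ Suc q) / x))"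
      by (simp add: f_def del: power_Suc)
    with s show ?thesis
      by (simp add: sums_iff del: power_Suc)
  qed
  show "set_integrable lborel {0<..} (\<lambda>x. pole_series q x / x)"
    using integrable_suminf[OF int AE_I2[OF sum1] sum2] unfolding eq set_integrable_def .
  show "(LINT x:{0<..}|lborel. pole_series q x / x) = pole_sum q"
    using integral_suminf[OF int AE_I2[OF sum1] sum2]
    unfolding eq val set_lebesgue_integral_def pole_sum_def .
qed

section \<open>Evaluation\<close>

lemma of_nat_powr_minus_of_nat:
  assumes "n > 0"
  shows "(of_nat n :: complex) powr (- of_nat s) = of_real (1 / real n ^ s)"
  using assms by (simp add: powr_minus powr_nat' field_simps)

lemma inverse_pole_power: "pi / pole j ^ Suc q = 2 ^ Suc q / pi ^ q * (1 / real (2 * j + 1) ^ Suc q)"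
proof -
  have "pole j = pi * (real (2 * j + 1) / 2)" by simp
  then show ?thesis
    by (simp only: power_mult_distrib power_divide power_Suc[of pi]) simp
qed

text \<open>Since \<open>c\<^sub>j\<close> = pi (2 j + 1) / 2, this is a sum over odd integers.
  Removing the even integers from the series of zeta(s) leaves (1 - 2^(-s)) zeta(s), and the factor
  2^s comes from the poles.\<close>

lemma pole_sum_even:
  assumes "p \<ge> 1"
  shows "of_real (pole_sum (2 * p)) =
    (2 ^ (2 * p + 1) - 1) * (zeta (of_nat (2 * p + 1)) / of_real pi ^ (2 * p))"
proof -
  define s where "s = 2 * p + 1"
  define f where "f r = 1 / real (Suc r) ^ s" for r
  \<comment> \<open>As \<open>f r\<close> belongs to the integer r + 1, the even indices are the odd
    integers.\<close>
  define a where "a = (\<Sum>j. f (2 * j))"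
  define Z where "Z = suminf f"
  have "summable (\<lambda>r. inverse ((1 + real r) ^ s))"
    using assms by (intro Polygamma_converges') (auto simp: s_def)
  then have sf: "summable f"
    by (simp add: f_def [abs_def] inverse_eq_divide add.commute)
  have se: "summable (\<lambda>j. f (2 * j))"
  proof (rule summable_comparison_test')
    show "norm (f (2 * j)) \<le> f j" for j
      by (auto simp: f_def intro!: divide_left_mono power_mono)
  qed (rule sf)
  have "f (2 * j + 1) = f j / 2 ^ s" for j
  proof -
    have "real (Suc (2 * j + 1)) = 2 * real (Suc j)" by simp
    then show ?thesis unfolding f_def by (simp only: power_mult_distrib) simp
  qed
  then have "(\<lambda>j. f (2 * j + 1)) sums (Z / 2 ^ s)"
    using sums_divide[OF summable_sums[OF sf]] by (simp add: Z_def)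
  with summable_sums[OF se] have "f sums (a + Z / 2 ^ s)"
    unfolding a_def by (rule sums_even_odd)
  then have "Z = a + Z / 2 ^ s"
    unfolding Z_def by (rule sums_unique[symmetric])
  then have aZ: "2 ^ s * a = (2 ^ s - 1) * Z" by (simp add: field_simps)
  have "zeta (of_nat s) = (\<Sum>r. of_real (f r))"
    unfolding zeta_def f_def by (simp only: of_nat_powr_minus_of_nat[OF zero_less_Suc])
  then have zeta: "zeta (of_nat s) = of_real Z"
    unfolding Z_def by (simp only: suminf_of_real[OF sf])
  have "pole_sum (2 * p) = (\<Sum>j. 2 ^ s / pi ^ (2 * p) * f (2 * j))"
    unfolding pole_sum_def f_def s_def using inverse_pole_power[of _ "2 * p"] by simp
  also have "\<dots> = 2 ^ s / pi ^ (2 * p) * a"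
    unfolding a_def by (rule suminf_mult[OF se])
  also have "\<dots> = (2 ^ s - 1) * (Z / pi ^ (2 * p))"
    using aZ by simp
  finally show ?thesis
    unfolding s_def[symmetric] zeta by simp
qed

text \<open>For the odd exponent 2 p - 1 the signs alternate, so the odd integers form the beta
  series directly.\<close>

lemma pole_sum_odd:
  assumes "p \<ge> 1"
  shows "of_real (pole_sum (2 * p - 1)) =
    2 ^ (2 * p) * (dirichlet_beta (of_nat (2 * p)) / of_real pi ^ (2 * p - 1))"
proof -
  define q where "q = 2 * p - 1"
  have q: "2 * p = Suc q" "odd q" using assms by (auto simp: q_def)
  define g where "g j = (-1) ^ j * (1 / real (2 * j + 1) ^ Suc q)" for j
  have sp: "summable (\<lambda>j. 1 / pole j ^ Suc q)"
    using assms by (intro summable_inverse_pole_power) (simp add: q_def)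
  have "summable (\<lambda>j. 1 / real (2 * j + 1) ^ Suc q)"
  proof -
    have "1 / real (2 * j + 1) ^ Suc q = (pi ^ q / 2 ^ Suc q * pi) * (1 / pole j ^ Suc q)" for j
    proof -
      have "(pi ^ q / 2 ^ Suc q * pi) * (1 / pole j ^ Suc q) = pi ^ q / 2 ^ Suc q * (pi / pole j ^ Suc q)"
        by (simp only: times_divide_eq_right mult_1_right mult.assoc)
      then show ?thesis unfolding inverse_pole_power by (simp del: power_Suc)
    qed
    then show ?thesis by (simp only: summable_mult[OF sp])
  qed
  then have sg: "summable g"
    by (rule summable_comparison_test'[where N = 0]) (auto simp: g_def abs_mult power_abs)
  have "dirichlet_beta (of_nat (Suc q)) = (\<Sum>j. of_real (g j))"
  proof -
    have "(of_nat (2 * j + 1) :: complex) powr (- of_nat (Suc q)) = of_real (1 / real (2 * j + 1) ^ Suc q)" for j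
      by (rule of_nat_powr_minus_of_nat) simp
    then show ?thesis
      unfolding dirichlet_beta_def g_def by (simp only: of_real_mult of_real_power of_real_minus of_real_1)
  qed
  then have beta: "dirichlet_beta (of_nat (Suc q)) = of_real (suminf g)"
    by (simp only: suminf_of_real[OF sg])
  have "pole_sum q = (\<Sum>j. 2 ^ Suc q / pi ^ q * g j)"
    unfolding pole_sum_def
  proof (rule arg_cong[where f = suminf], rule ext)
    fix j
    have "alt_sign q j * pi / pole j ^ Suc q = (-1) ^ j * (pi / pole j ^ Suc q)"
      using q by (simp del: power_Suc)
    also have "\<dots> = 2 ^ Suc q / pi ^ q * g j"
      unfolding inverse_pole_power g_def by (simp only: mult_ac)
    finally show "alt_sign q j * pi / pole j ^ Suc q = 2 ^ Suc q / pi ^ q * g j" .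
  qed
  also have "\<dots> = 2 ^ Suc q * (suminf g / pi ^ q)"
    by (subst suminf_mult[OF sg]) simp
  finally show ?thesis
    unfolding q_def[symmetric] q(1) beta by simp
qed

section \<open>Expansion of the integrands and assembly of the two formulas\<close>

definition chebyshev_arcsin_coeff :: "nat \<Rightarrow> nat \<Rightarrow> nat \<Rightarrow> complex" where
  "chebyshev_arcsin_coeff k q m = taylor_coeff (\<lambda>z. poly (chebyshev_U (2 * k)) z * Arcsin z ^ q) m"

lemma chebyshev_arcsin_coeff_eq: "chebyshev_arcsin_coeff k q m = (\<Sum>i\<le>m. coeff (chebyshev_U (2 * k)) i * arcsin_power_coeff q (m - i))"
  unfolding chebyshev_arcsin_coeff_def by (rule taylor_coeff_poly_Arcsin_power)

text \<open>The polynomial \<open>U\<^sub>2\<^sub>k\<close> is even and arcsin^q has the parity of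
  q.\<close>

lemma chebyshev_arcsin_coeff_eq_0:
  assumes "odd (q + m)"
  shows "chebyshev_arcsin_coeff k q m = 0"
  unfolding chebyshev_arcsin_coeff_eq
proof (intro sum.neutral ballI)
  fix i assume "i \<in> {..m}"
  show "coeff (chebyshev_U (2 * k)) i * arcsin_power_coeff q (m - i) = 0"
  proof (cases "even i")
    case True
    then have "odd (m - i + q)" using assms \<open>i \<in> {..m}\<close> by auto
    then show ?thesis by (simp add: arcsin_power_coeff_eq_0)
  qed (simp add: coeff_chebyshev_U_eq_0)
qed

text \<open>Write sinh((2 k + 1) x) as \<open>U\<^sub>2\<^sub>k(cosh x)\<close> sinh x. The monomial
  cosh^i turns the quotient into \<open>D\<^sub>m\<^sub>-\<^sub>i(x)\<close> / x, and exchanging the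
  sums over i and q assembles the Cauchy product for the coefficient of z^m.\<close>

lemma integrand_expansion:
  assumes "2 * k < m" "x > 0"
  shows "of_real (sinh (real (2 * k + 1) * x) / (x * cosh x ^ Suc m)) =
    (\<Sum>q = 1..m. chebyshev_arcsin_coeff k q m * of_real (pole_series q x / x))"
proof -
  let ?u = "coeff (chebyshev_U (2 * k))" and ?c = "of_real (cosh x) :: complex"
  have "of_real (sinh (real (2 * k + 1) * x) / (x * cosh x ^ Suc m)) =
     poly (chebyshev_U (2 * k)) ?c * of_real (sinh x) / (of_real x * ?c ^ Suc m)"
    using assms(2) by (subst chebyshev_U_cosh) (simp_all add: field_simps)
  also have "poly (chebyshev_U (2 * k)) ?c = (\<Sum>i\<le>m. ?u i * ?c ^ i)"
  proof -
    have "degree (chebyshev_U (2 * k)) \<le> 2 * k"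
      by (intro degree_le allI impI coeff_chebyshev_U_eq_0 disjI1)
    then show ?thesis
      unfolding poly_altdef using assms(1)
      by (intro sum.mono_neutral_left) (auto simp: coeff_eq_0)
  qed
  also have "(\<Sum>i\<le>m. ?u i * ?c ^ i) * of_real (sinh x) / (of_real x * ?c ^ Suc m)
      = (\<Sum>i\<le>m. ?u i * (of_real (sinh x / cosh x ^ Suc (m - i)) / of_real x))"
    unfolding sum_distrib_right sum_divide_distrib
  proof (rule sum.cong[OF refl])
    fix i assume "i \<in> {..m}"
    then have "?c ^ Suc m = ?c ^ i * ?c ^ Suc (m - i)"
      by (simp flip: power_add)
    then show "?u i * ?c ^ i * of_real (sinh x) / (of_real x * ?c ^ Suc m)
        = ?u i * (of_real (sinh x / cosh x ^ Suc (m - i)) / of_real x)"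
      by (simp del: power_Suc)
  qed
  also have "\<dots> = (\<Sum>i\<le>m. \<Sum>q = 1..m. ?u i * arcsin_power_coeff q (m - i) * of_real (pole_series q x / x))"
  proof (rule sum.cong[OF refl])
    fix i assume i: "i \<in> {..m}"
    show "?u i * (of_real (sinh x / cosh x ^ Suc (m - i)) / of_real x)
        = (\<Sum>q = 1..m. ?u i * arcsin_power_coeff q (m - i) * of_real (pole_series q x / x))"
    \<comment> \<open>For i <= 2 k the hypothesis gives m - i > 0, as the hyperbolic expansion
      requires; for larger i the Chebyshev coefficient is zero.\<close>
    proof (cases "i \<le> 2 * k")
      case True
      then have "0 < m - i" using assms(1) by simp
      then show ?thesis
        by (subst sinh_over_cosh_power_expansion[of "m - i" m])
           (simp_all add: sum_distrib_left sum_divide_distrib mult_ac)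
    qed (simp add: coeff_chebyshev_U_eq_0)
  qed
  also have "\<dots> = (\<Sum>q = 1..m. chebyshev_arcsin_coeff k q m * of_real (pole_series q x / x))"
    unfolding chebyshev_arcsin_coeff_eq sum_distrib_right by (rule sum.swap)
  finally show ?thesis .
qed

text \<open>Both formulas of the theorem are instances, with m = 2 n and m = 2 n - 1. The Taylor
  coefficients are complex numbers, so the integration is carried out on complex-valued
  functions.\<close>

lemma integral_sinh_over_cosh_power:
  fixes k m :: nat
  assumes "2 * k < m"
  defines "f \<equiv> \<lambda>x. sinh (real (2 * k + 1) * x) / (x * cosh x ^ Suc m)"
  shows "f absolutely_integrable_on {0<..}"
    and "of_real (integral {0<..} f) = (\<Sum>q = 1..m. chebyshev_arcsin_coeff k q m * of_real (pole_sum q))"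
proof -
  let ?g = "\<lambda>x. indicator {0<..} x *\<^sub>R f x"
  let ?h = "\<lambda>q x. indicator {0<..} x *\<^sub>R (pole_series q x / x)"
  have h: "integrable lborel (\<lambda>x. complex_of_real (?h q x))"
    "(\<integral>x. complex_of_real (?h q x) \<partial>lborel) = of_real (pole_sum q)" if "q \<in> {1..m}" for q
    using integral_pole_series[of q] that
    unfolding set_integrable_def set_lebesgue_integral_def
    by (simp_all only: complex_of_real_integrable_eq integral_complex_of_real atLeastAtMost_iff less_eq_Suc_le One_nat_def)
  have eq: "complex_of_real (?g x) = (\<Sum>q = 1..m. chebyshev_arcsin_coeff k q m * complex_of_real (?h q x))" for x
    using integrand_expansion[OF assms(1), of x]
    by (cases "x > 0") (simp_all add: f_def)
  have "integrable lborel (\<lambda>x. complex_of_real (?g x))"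
    unfolding eq by (intro Bochner_Integration.integrable_sum integrable_mult_right h)
  then have g: "integrable lborel ?g"
    by (simp only: complex_of_real_integrable_eq)
  then show "f absolutely_integrable_on {0<..}"
    unfolding set_integrable_def by (simp add: integrable_completion)
  have "(\<integral>x. complex_of_real (?g x) \<partial>lborel)
      = (\<Sum>q = 1..m. \<integral>x. chebyshev_arcsin_coeff k q m * complex_of_real (?h q x) \<partial>lborel)"
    unfolding eq by (intro Bochner_Integration.integral_sum integrable_mult_right h)
  also have "\<dots> = (\<Sum>q = 1..m. chebyshev_arcsin_coeff k q m * of_real (pole_sum q))"
    by (intro sum.cong refl) (simp only: integral_mult_right_zero h(2))
  finally have "(\<integral>x. complex_of_real (?g x) \<partial>lborel) = (\<Sum>q = 1..m. chebyshev_arcsin_coeff k q m * of_real (pole_sum q))" .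
  moreover have "integral\<^sup>L lborel ?g = integral {0<..} f"
    using set_borel_integral_eq_integral(2)[of "{0<..}" f] g
    by (simp add: set_integrable_def set_lebesgue_integral_def)
  ultimately show "of_real (integral {0<..} f) = (\<Sum>q = 1..m. chebyshev_arcsin_coeff k q m * of_real (pole_sum q))"
    by (simp only: integral_complex_of_real)
qed

theorem proposition1p2:
  fixes n k :: nat
  assumes "n \<ge> 1" and "k < n"
  shows
    "((\<lambda>x::real. sinh (real (2 * k + 1) * x) / (x * cosh x ^ (2 * n + 1)))
        absolutely_integrable_on {0<..} \<and>
      complex_of_real (integral {0<..}
        (\<lambda>x::real. sinh (real (2 * k + 1) * x) / (x * cosh x ^ (2 * n + 1)))) =
      (\<Sum>p = 1..n. (2 ^ (2 * p + 1) - 1) *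
         taylor_coeff (\<lambda>z. poly (chebyshev_U (2 * k)) z * Arcsin z ^ (2 * p)) (2 * n) *
         (zeta (of_nat (2 * p + 1)) / complex_of_real pi ^ (2 * p)))) \<and>
     ((\<lambda>x::real. sinh (real (2 * k + 1) * x) / (x * cosh x ^ (2 * n)))
        absolutely_integrable_on {0<..} \<and>
      complex_of_real (integral {0<..}
        (\<lambda>x::real. sinh (real (2 * k + 1) * x) / (x * cosh x ^ (2 * n)))) =
      (\<Sum>p = 1..n. 2 ^ (2 * p) *
         taylor_coeff (\<lambda>z. poly (chebyshev_U (2 * k)) z * Arcsin z ^ (2 * p - 1)) (2 * n - 1) *
         (dirichlet_beta (of_nat (2 * p)) / complex_of_real pi ^ (2 * p - 1))))"
proof -
  \<comment> \<open>Parity leaves only q = 2 p here, and only q = 2 p - 1 in the companion sum with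
    m = 2 n - 1.\<close>
  have even: "(\<Sum>q = 1..2 * n. chebyshev_arcsin_coeff k q (2 * n) * of_real (pole_sum q)) =
    (\<Sum>p = 1..n. (2 ^ (2 * p + 1) - 1) * chebyshev_arcsin_coeff k (2 * p) (2 * n) *
         (zeta (of_nat (2 * p + 1)) / complex_of_real pi ^ (2 * p)))"
  proof -
    have "(\<Sum>q = 1..2 * n. chebyshev_arcsin_coeff k q (2 * n) * of_real (pole_sum q)) =
      (\<Sum>q \<in> (\<lambda>p. 2 * p) ` {1..n}. chebyshev_arcsin_coeff k q (2 * n) * of_real (pole_sum q))"
    proof (rule sum.mono_neutral_right)
      show "\<forall>q \<in> {1..2 * n} - (\<lambda>p. 2 * p) ` {1..n}. chebyshev_arcsin_coeff k q (2 * n) * of_real (pole_sum q) = 0"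
        by (force intro: chebyshev_arcsin_coeff_eq_0 elim: evenE)
    qed auto
    also have "\<dots> = (\<Sum>p = 1..n. chebyshev_arcsin_coeff k (2 * p) (2 * n) * of_real (pole_sum (2 * p)))"
      by (simp add: sum.reindex inj_on_def)
    also have "\<dots> = (\<Sum>p = 1..n. (2 ^ (2 * p + 1) - 1) * chebyshev_arcsin_coeff k (2 * p) (2 * n) *
         (zeta (of_nat (2 * p + 1)) / complex_of_real pi ^ (2 * p)))"
      by (intro sum.cong refl, subst pole_sum_even) (auto simp only: mult_ac atLeastAtMost_iff)
    finally show ?thesis .
  qed
  have odd: "(\<Sum>q = 1..2 * n - 1. chebyshev_arcsin_coeff k q (2 * n - 1) * of_real (pole_sum q)) =
    (\<Sum>p = 1..n. 2 ^ (2 * p) * chebyshev_arcsin_coeff k (2 * p - 1) (2 * n - 1) *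
         (dirichlet_beta (of_nat (2 * p)) / complex_of_real pi ^ (2 * p - 1)))"
  proof -
    have "(\<Sum>q = 1..2 * n - 1. chebyshev_arcsin_coeff k q (2 * n - 1) * of_real (pole_sum q)) =
      (\<Sum>q \<in> (\<lambda>p. 2 * p - 1) ` {1..n}. chebyshev_arcsin_coeff k q (2 * n - 1) * of_real (pole_sum q))"
    proof (rule sum.mono_neutral_right)
      show "\<forall>q \<in> {1..2 * n - 1} - (\<lambda>p. 2 * p - 1) ` {1..n}. chebyshev_arcsin_coeff k q (2 * n - 1) * of_real (pole_sum q) = 0"
      proof
        fix q assume q: "q \<in> {1..2 * n - 1} - (\<lambda>p. 2 * p - 1) ` {1..n}"
        have "even q"
        proof (rule ccontr)
          assume "odd q"
          then obtain r where "q = 2 * (r + 1) - 1" by (auto elim: oddE)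
          moreover from this have "r + 1 \<in> {1..n}" using q by auto
          ultimately have "q \<in> (\<lambda>p. 2 * p - 1) ` {1..n}" by (rule image_eqI)
          with q show False by simp
        qed
        then show "chebyshev_arcsin_coeff k q (2 * n - 1) * of_real (pole_sum q) = 0"
          using assms(1) by (simp add: chebyshev_arcsin_coeff_eq_0)
      qed
    qed auto
    also have "\<dots> = (\<Sum>p = 1..n. chebyshev_arcsin_coeff k (2 * p - 1) (2 * n - 1) * of_real (pole_sum (2 * p - 1)))"
      by (subst sum.reindex) (auto simp: inj_on_def)
    also have "\<dots> = (\<Sum>p = 1..n. 2 ^ (2 * p) * chebyshev_arcsin_coeff k (2 * p - 1) (2 * n - 1) *
         (dirichlet_beta (of_nat (2 * p)) / complex_of_real pi ^ (2 * p - 1)))"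
      by (intro sum.cong refl, subst pole_sum_odd) (auto simp only: mult_ac atLeastAtMost_iff)
    finally show ?thesis .
  qed
  \<comment> \<open>From k < n follows 2 k <= 2 n - 2, which is what the odd case m = 2 n - 1
    demands.\<close>
  have "Suc (2 * n) = 2 * n + 1" "Suc (2 * n - 1) = 2 * n" "2 * k < 2 * n" "2 * k < 2 * n - 1"
    using assms by auto
  then show ?thesis
    using integral_sinh_over_cosh_power[of k "2 * n"] integral_sinh_over_cosh_power[of k "2 * n - 1"]
    unfolding even odd by (simp only: chebyshev_arcsin_coeff_def simp_thms)
qed

end
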